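(* Let $\eta:[0,1]\to V_1$. The following are equivalent: (1) $\eta$ is Lipschitz and $\eta(0)=0$. (2) There exist a bounded measurable horizontal input $K\in L^\infty([0,\infty);V_1)$ and a sequence $T_j\to\infty$ such that, for $\ell(t)=\int_0^tK(s)\,ds$, the path $\eta$ is a macroscopic horizontal path along $(T_j)$.
   Context: $V_1$ is the first layer of a finite-dimensional real graded nilpotent Lie algebra $\mathfrak g=V_1\oplus\cdots\oplus V_n$; for this statement only the fact that $V_1$ is a finite-dimensional real vector space with a fixed norm $\|\cdot\|$ matters. For a path $\gamma:[a,b]\to V_1$, $\operatorname{Var}(\gamma;[a,b])=\sup\sum_i\|\gamma(t_i)-\gamma(t_{i-1})\|$ over partitions of $[a,b]$; $\gamma$ has bounded variation (BV) if this is finite. For $\ell:[0,\infty)\to V_1$ continuous and BV on compact intervals, and $T>0$, put $\ell_T(u)=(\ell(Tu)-\ell(0))/T$, $0\le u\le1$. For $T_j\to\infty$, a continuous BV path $\ell^\infty:[0,1]\to V_1$ is a macroscopic horizontal path (of $\ell$) along $(T_j)$ if $\ell_{T_j}\to\ell^\infty$ uniformly on $[0,1]$ and $\sup_j\operatorname{Var}(\ell_{T_j};[0,1])<\infty$. *)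

theory Defs
  imports "HOL-Analysis.Analysis"
begin

text \<open>
  Finite dimension is a predicate on the type rather than the class of Euclidean spaces, because
  the latter would force the norm to come from an inner product. A finite-dimensional real
  normed space is automatically complete and second countable, so where the sorts
  \<open>banach\<close> and \<open>second_countable_topology\<close> (required for the Bochner
  integral) appear together with this predicate, they are no restriction.

  Paths on an interval and inputs on the half line are total functions on the reals; their values
  outside the interval or half line are irrelevant.
\<close>

definition finite_dimensional_type :: "'a::real_vector itself \<Rightarrow> bool" where
  "finite_dimensional_type _ \<longleftrightarrow> (\<exists>B::'a set. finite B \<and> span B = UNIV)"

definition interval_partitions :: "real \<Rightarrow> real \<Rightarrow> (nat \<times> (nat \<Rightarrow> real)) set" where
  "interval_partitions a b =
     {(n, t). t 0 = a \<and> t n = b \<and> (\<forall>i<n. t i < t (Suc i))}"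

definition path_variation :: "(real \<Rightarrow> 'a::real_normed_vector) \<Rightarrow> real \<Rightarrow> real \<Rightarrow> ennreal" where
  "path_variation \<gamma> a b =
     (SUP (n, t) \<in> interval_partitions a b. \<Sum>i<n. ennreal (norm (\<gamma> (t (Suc i)) - \<gamma> (t i))))"

definition bounded_variation :: "(real \<Rightarrow> 'a::real_normed_vector) \<Rightarrow> real \<Rightarrow> real \<Rightarrow> bool" where
  "bounded_variation \<gamma> a b \<longleftrightarrow> path_variation \<gamma> a b < \<infinity>"

definition rescaled_path :: "(real \<Rightarrow> 'a::real_normed_vector) \<Rightarrow> real \<Rightarrow> real \<Rightarrow> 'a" where
  "rescaled_path l T u = (l (T * u) - l 0) /\<^sub>R T"

text \<open>The first five conjuncts are the standing assumptions on the path, the scales and the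
  limit; positivity of every scale is needed for the rescaled paths to make sense.\<close>

definition macroscopic_horizontal_path ::
  "(real \<Rightarrow> 'a::real_normed_vector) \<Rightarrow> (nat \<Rightarrow> real) \<Rightarrow> (real \<Rightarrow> 'a) \<Rightarrow> bool" where
  "macroscopic_horizontal_path l T \<eta> \<longleftrightarrow>
     continuous_on {0..} l \<and>
     (\<forall>a b. 0 \<le> a \<and> a \<le> b \<longrightarrow> bounded_variation l a b) \<and>
     (\<forall>j. T j > 0) \<and> filterlim T at_top sequentially \<and>
     (continuous_on {0..1} \<eta> \<and> bounded_variation \<eta> 0 1) \<and>
     uniform_limit {0..1} (\<lambda>j. rescaled_path l (T j)) \<eta> sequentially \<and>
     (SUP j. path_variation (rescaled_path l (T j)) 0 1) < \<infinity>"

text \<open>Representatives of elements of $L^\infty([0,\infty);V_1)$: Lebesgue measurable and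
  essentially bounded.\<close>

definition bounded_measurable_input :: "(real \<Rightarrow> 'a::real_normed_vector) \<Rightarrow> bool" where
  "bounded_measurable_input K \<longleftrightarrow>
     K \<in> borel_measurable (lebesgue_on {0..}) \<and>
     (\<exists>M. AE s in lebesgue_on {0..}. norm (K s) \<le> M)"

definition integrated_path ::
  "(real \<Rightarrow> 'a::{banach, second_countable_topology}) \<Rightarrow> real \<Rightarrow> 'a" where
  "integrated_path K t = (LINT s:{0..t}|lebesgue. K s)"

end

theory Submission
  imports Defs
begin

text \<open>
  An integrated bounded input is Lipschitz, hence so are its rescalings, with the same constant,
  and their pointwise limits. Conversely, for a Lipschitz \<open>\<eta>\<close> no derivative is
  required, because only uniform convergence is asked for: on the block \<open>((j-1)!, j!]\<close>
  let the input be the slopes of the interpolation of \<open>\<eta>\<close> on the grid of mesh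
  \<open>1/j!\<close>, spread over unit intervals. Along \<open>T\<^sub>j = j!\<close> the path copies
  \<open>\<eta>\<close> at the grid points beyond \<open>(j-1)!/j! = 1/j\<close>, and everything before
  that contributes \<open>O(1/j)\<close>.
\<close>

section \<open>Variation of Lipschitz paths\<close>

text \<open>Each increment is at most \<open>M\<close> times the length of its step, and the step
  lengths telescope to \<open>b - a\<close>.\<close>

lemma lipschitz_path_variation_le:
  assumes "M-lipschitz_on {a..b} \<gamma>"
  shows "path_variation \<gamma> a b \<le> ennreal (M * (b - a))"
  unfolding path_variation_def
proof (rule SUP_least, clarsimp simp: interval_partitions_def simp del: sum_ennreal)
  fix n t
  assume a: "a = t 0" and b: "b = t n" and step: "\<forall>i<n. t i < t (Suc i)"
  have M: "M \<ge> 0"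
    using assms lipschitz_on_nonneg by blast
  \<comment> \<open>Monotonicity keeps all partition points in \<open>{a..b}\<close>, where the
    Lipschitz bound is available.\<close>
  have mono: "t i \<le> t j" if "i \<le> j" "j \<le> n" for i j
    using that
  proof (induction j rule: dec_induct)
    case (step m)
    then show ?case
      using \<open>\<forall>i<n. t i < t (Suc i)\<close> by (meson Suc_le_lessD less_imp_le order_trans)
  qed simp
  have "(\<Sum>i<n. ennreal (norm (\<gamma> (t (Suc i)) - \<gamma> (t i))))
      \<le> (\<Sum>i<n. ennreal (M * (t (Suc i) - t i)))"
  proof (intro sum_mono ennreal_leI)
    fix i assume "i \<in> {..<n}"
    then have i: "i < n" by simp
    have "t i \<in> {a..b}" "t (Suc i) \<in> {a..b}"
      using mono[of 0 i] mono[of i n] mono[of 0 "Suc i"] mono[of "Suc i" n] i a b by auto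
    then show "norm (\<gamma> (t (Suc i)) - \<gamma> (t i)) \<le> M * (t (Suc i) - t i)"
      using lipschitz_onD[OF assms, of "t (Suc i)" "t i"] step i
      by (auto simp: dist_norm dist_real_def)
  qed
  also have "\<dots> = ennreal (\<Sum>i<n. M * (t (Suc i) - t i))"
    using step M by (intro sum_ennreal mult_nonneg_nonneg) (auto intro: less_imp_le)
  also have "(\<Sum>i<n. M * (t (Suc i) - t i)) = M * (t n - t 0)"
    by (simp add: sum_lessThan_telescope flip: sum_distrib_left)
  finally show "(\<Sum>i<n. ennreal (norm (\<gamma> (t (Suc i)) - \<gamma> (t i))))
      \<le> ennreal (M * (t n - t 0))" .
qed

section \<open>Integration of bounded inputs\<close>

text \<open>Measurability and the essential bound are given for \<open>lebesgue_on {0..}\<close>.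
  Cutting off by the indicator of \<open>A\<close> carries both over to \<open>lebesgue\<close>,
  where a constant dominates on a set of finite measure.\<close>

lemma bounded_measurable_input_set_integrable:
  fixes K :: "real \<Rightarrow> 'a::{banach, second_countable_topology}"
  assumes K: "bounded_measurable_input K"
    and A: "A \<in> sets lebesgue" "A \<subseteq> {0..}" "emeasure lebesgue A < \<infinity>"
  shows "set_integrable lebesgue A K"
proof -
  obtain M where meas: "K \<in> borel_measurable (lebesgue_on {0..})"
    and M: "AE s in lebesgue_on {0..}. norm (K s) \<le> M"
    using K unfolding bounded_measurable_input_def by blast
  have "(\<lambda>s. indicat_real {0..} s *\<^sub>R K s) \<in> borel_measurable lebesgue"
    using meas by (subst (asm) borel_measurable_restrict_space_iff) auto
  then have "(\<lambda>s. indicat_real A s *\<^sub>R (indicat_real {0..} s *\<^sub>R K s)) \<in> borel_measurable lebesgue"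
    using A by measurable
  also have "(\<lambda>s. indicat_real A s *\<^sub>R (indicat_real {0..} s *\<^sub>R K s)) = (\<lambda>s. indicat_real A s *\<^sub>R K s)"
    using A by (auto simp: indicator_def fun_eq_iff)
  finally have measA: "set_borel_measurable lebesgue A K"
    unfolding set_borel_measurable_def .
  have "AE s in lebesgue. s \<in> {0..} \<longrightarrow> norm (K s) \<le> M"
    using M by (subst (asm) AE_restrict_space_iff) auto
  then have bd: "AE s in lebesgue. s \<in> A \<longrightarrow> norm (K s) \<le> M"
    by eventually_elim (use A in auto)
  have "set_integrable lebesgue A (\<lambda>_. M)"
    using A unfolding set_integrable_def by (intro integrable_scaleR_left integrable_real_indicator)
  then show ?thesis
    by (rule set_integrable_bound[OF _ measA]) (use bd in \<open>eventually_elim, fastforce\<close>)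
qed

lemma integrated_path_diff:
  fixes K :: "real \<Rightarrow> 'a::{banach, second_countable_topology}"
  assumes "bounded_measurable_input K" "0 \<le> s" "s \<le> t"
  shows "integrated_path K t - integrated_path K s = (LINT r:{s<..t}|lebesgue. K r)"
proof -
  have "{0..t} = {0..s} \<union> {s<..t}"
    using assms by auto
  then have "integrated_path K t
      = (LINT r:{0..s}|lebesgue. K r) + (LINT r:{s<..t}|lebesgue. K r)"
    unfolding integrated_path_def using assms
    by (simp only:, subst set_integral_Un)
      (auto intro!: bounded_measurable_input_set_integrable)
  then show ?thesis
    by (simp add: integrated_path_def)
qed

lemma integrated_path_lipschitz:
  fixes K :: "real \<Rightarrow> 'a::{banach, second_countable_topology}"
  assumes K: "bounded_measurable_input K"
  obtains M where "M-lipschitz_on {0..} (integrated_path K)"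
proof -
  obtain M0 where M0: "AE s in lebesgue_on {0..}. norm (K s) \<le> M0"
    using K unfolding bounded_measurable_input_def by blast
  \<comment> \<open>A Lipschitz constant has to be nonnegative; the maximum saves deriving this from
    the essential bound.\<close>
  define M where "M = max M0 0"
  have M: "AE s in lebesgue. s \<in> {0..} \<longrightarrow> norm (K s) \<le> M"
    using M0 by (subst (asm) AE_restrict_space_iff) (auto simp: M_def elim: eventually_mono)
  have incr: "norm (integrated_path K t - integrated_path K s) \<le> M * (t - s)"
    if "0 \<le> s" "s \<le> t" for s t
  proof -
    have int: "set_integrable lebesgue {s<..t} K"
      by (rule bounded_measurable_input_set_integrable[OF K]) (use that in auto)
    have "norm (LINT r:{s<..t}|lebesgue. K r) \<le> (LINT r:{s<..t}|lebesgue. norm (K r))"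
      using set_integral_norm_bound[OF int] .
    also have "\<dots> \<le> (LINT r:{s<..t}|lebesgue. M)"
      using set_integrable_norm[OF int] M that
      by (intro set_integral_mono_AE)
        (auto simp: set_integrable_def intro!: integrable_scaleR_left integrable_real_indicator
          elim: eventually_mono)
    also have "\<dots> = M * (t - s)"
      using that by (simp add: set_lebesgue_integral_def)
    finally show ?thesis
      using integrated_path_diff[OF K that] by simp
  qed
  have "M-lipschitz_on {0..} (integrated_path K)"
  proof (rule lipschitz_onI)
    show "0 \<le> M" by (simp add: M_def)
    fix x y :: real
    assume "x \<in> {0..}" "y \<in> {0..}"
    then show "dist (integrated_path K x) (integrated_path K y) \<le> M * dist x y"
      using incr[of x y] incr[of y x]
      by (cases "x \<le> y") (auto simp: dist_norm norm_minus_commute)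
  qed
  then show ?thesis using that by blast
qed

section \<open>Rescaled Lipschitz paths and their limits\<close>

text \<open>The factor \<open>T\<close> gained in the argument cancels against the division by
  \<open>T\<close>. The constant is thus the same at all scales, which yields both the uniform
  variation bound and a Lipschitz limit.\<close>

lemma rescaled_path_lipschitz:
  assumes "M-lipschitz_on {0..} l" "T > 0"
  shows "M-lipschitz_on {0..} (rescaled_path l T)"
proof (rule lipschitz_onI)
  show "0 \<le> M"
    using assms lipschitz_on_nonneg by blast
  fix x y :: real
  assume "x \<in> {0..}" "y \<in> {0..}"
  then have "norm (l (T * x) - l (T * y)) \<le> M * \<bar>T * x - T * y\<bar>"
    using lipschitz_onD[OF assms(1), of "T * x" "T * y"] assms(2)
    by (simp add: dist_norm dist_real_def)
  also have "\<dots> = T * (M * \<bar>x - y\<bar>)"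
    using assms(2) by (simp add: abs_mult flip: right_diff_distrib)
  finally have "norm (l (T * x) - l (T * y)) / T \<le> M * \<bar>x - y\<bar>"
    using assms(2) by (simp add: field_simps)
  moreover have "rescaled_path l T x - rescaled_path l T y = (l (T * x) - l (T * y)) /\<^sub>R T"
    by (simp add: rescaled_path_def algebra_simps)
  ultimately show "dist (rescaled_path l T x) (rescaled_path l T y) \<le> M * dist x y"
    using assms(2) by (simp add: dist_norm dist_real_def divide_inverse mult.commute)
qed

lemma lipschitz_on_pointwise_limit:
  assumes "\<And>j. M-lipschitz_on S (f j)" "\<And>x. x \<in> S \<Longrightarrow> (\<lambda>j. f j x) \<longlonglongrightarrow> g x"
  shows "M-lipschitz_on S g"
proof (rule lipschitz_onI)
  show "0 \<le> M"
    using assms(1) lipschitz_on_nonneg by blast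
  fix x y
  assume xy: "x \<in> S" "y \<in> S"
  have "(\<lambda>j. dist (f j x) (f j y)) \<longlonglongrightarrow> dist (g x) (g y)"
    using assms(2) xy by (intro tendsto_dist)
  then show "dist (g x) (g y) \<le> M * dist x y"
    by (rule LIMSEQ_le_const2) (use lipschitz_onD[OF assms(1)] xy in auto)
qed

text \<open>Continuity and all variation bounds come from the Lipschitz constants, so for the
  constructed input the real work is uniform convergence.\<close>

lemma lipschitz_imp_macroscopic_horizontal_path:
  assumes l: "M-lipschitz_on {0..} l" and T: "\<And>j. T j > 0" "filterlim T at_top sequentially"
    and \<eta>: "L-lipschitz_on {0..1} \<eta>"
    and lim: "uniform_limit {0..1} (\<lambda>j. rescaled_path l (T j)) \<eta> sequentially"
  shows "macroscopic_horizontal_path l T \<eta>"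
  unfolding macroscopic_horizontal_path_def
proof (intro conjI allI impI)
  show "continuous_on {0..} l" "continuous_on {0..1} \<eta>"
    using l \<eta> lipschitz_on_continuous_on by blast+
  show "bounded_variation l a b" if "0 \<le> a \<and> a \<le> b" for a b
  proof -
    have "M-lipschitz_on {a..b} l"
      using l by (rule lipschitz_on_subset) (use that in auto)
    then show ?thesis
      unfolding bounded_variation_def
      using lipschitz_path_variation_le le_less_trans ennreal_less_top by (metis infinity_ennreal_def)
  qed
  show "bounded_variation \<eta> 0 1"
    unfolding bounded_variation_def
    using lipschitz_path_variation_le[OF \<eta>] le_less_trans ennreal_less_top
    by (metis infinity_ennreal_def)
  have "M-lipschitz_on {0..1} (rescaled_path l (T j))" for j
    using rescaled_path_lipschitz[OF l T(1)] by (rule lipschitz_on_subset) auto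
  then have "(SUP j. path_variation (rescaled_path l (T j)) 0 1) \<le> ennreal (M * (1 - 0))"
    by (intro SUP_least lipschitz_path_variation_le)
  then show "(SUP j. path_variation (rescaled_path l (T j)) 0 1) < \<infinity>"
    using le_less_trans ennreal_less_top by (metis infinity_ennreal_def)
qed (use T lim in auto)

section \<open>Piecewise constant inputs\<close>

text \<open>Ceilings rather than floors, so that the input is constant on \<open>(n, n+1]\<close>,
  the set over which \<open>integrated_path_diff\<close> integrates. Truncated subtraction puts
  the point \<open>0\<close> in the first step.\<close>

definition step_input :: "(nat \<Rightarrow> 'a) \<Rightarrow> real \<Rightarrow> 'a" where
  "step_input k s = k (nat \<lceil>s\<rceil> - 1)"

lemma step_input_bounded_measurable:
  fixes k :: "nat \<Rightarrow> 'a::real_normed_vector"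
  assumes "\<And>n. norm (k n) \<le> M"
  shows "bounded_measurable_input (step_input k)"
proof -
  \<comment> \<open>The input factors through the integers with the discrete sigma-algebra, on which
    every function is measurable.\<close>
  have "(\<lambda>s::real. \<lceil>s\<rceil>) \<in> borel \<rightarrow>\<^sub>M count_space UNIV"
    by simp
  then have "step_input k \<in> borel_measurable borel"
    unfolding step_input_def by (rule measurable_compose) simp
  then have "step_input k \<in> borel_measurable lebesgue"
    by (intro measurable_completion) simp
  then have "step_input k \<in> borel_measurable (lebesgue_on {0..})"
    by (rule measurable_restrict_space1)
  then show ?thesis
    using assms unfolding bounded_measurable_input_def step_input_def by blast
qed

lemma integrated_path_step_input:
  fixes k :: "nat \<Rightarrow> 'a::{banach, second_countable_topology}"
  assumes "\<And>n. norm (k n) \<le> M"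
  shows "integrated_path (step_input k) (real n) = (\<Sum>i<n. k i)"
proof (induction n)
  case 0
  \<comment> \<open>The interval has shrunk to a null set; once the integrand is frozen to a
    constant, the integral can be evaluated directly.\<close>
  have "(LINT s:{0::real}|lebesgue. step_input k s) = (LINT s:{0::real}|lebesgue. step_input k 0)"
    by (rule set_lebesgue_integral_cong) auto
  then show ?case
    by (simp add: integrated_path_def set_lebesgue_integral_def)
next
  case (Suc n)
  have "(LINT s:{real n<..real (Suc n)}|lebesgue. step_input k s)
      = (LINT s:{real n<..real (Suc n)}|lebesgue. k n)"
  proof (rule set_lebesgue_integral_cong)
    show "\<forall>s. s \<in> {real n<..real (Suc n)} \<longrightarrow> step_input k s = k n"
    proof (intro allI impI)
      fix s assume "s \<in> {real n<..real (Suc n)}"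
      then have "\<lceil>s\<rceil> = int (Suc n)"
        by (simp add: ceiling_eq_iff)
      then have "nat \<lceil>s\<rceil> = Suc n"
        by (simp only: nat_int)
      then show "step_input k s = k n"
        by (simp add: step_input_def)
    qed
  qed simp
  also have "\<dots> = k n"
    by (simp add: set_lebesgue_integral_def)
  finally show ?case
    using integrated_path_diff[OF step_input_bounded_measurable[of k, OF assms],
        of "real n" "real (Suc n)"] Suc
    by (simp add: algebra_simps)
qed

section \<open>Slopes on factorial blocks\<close>

text \<open>Slope number \<open>n\<close> acts on \<open>(n, n+1]\<close>, so the indices from
  \<open>fact j\<close> to \<open>fact (Suc j) - 1\<close> form block \<open>Suc j\<close>. Block 0
  consists of the index 0, and block 1 is empty because \<open>fact 0 = fact 1\<close>.\<close>

definition factorial_block :: "nat \<Rightarrow> nat" where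
  "factorial_block n = (LEAST j. n < fact j)"

definition block_slope :: "(real \<Rightarrow> 'a::real_vector) \<Rightarrow> nat \<Rightarrow> 'a" where
  "block_slope \<eta> n = (let N = fact (factorial_block n) in
     N *\<^sub>R (\<eta> (real (Suc n) / N) - \<eta> (real n / N)))"

text \<open>Some factorial exceeds \<open>n\<close>, so the least index exists. Consequently both
  grid points in \<open>block_slope\<close> lie in \<open>{0..1}\<close>.\<close>

lemma less_fact_factorial_block: "n < fact (factorial_block n)"
proof -
  have "n < fact (Suc n)"
    using fact_ge_self[of "Suc n"] by linarith
  then show ?thesis
    unfolding factorial_block_def by (rule LeastI)
qed

lemma factorial_block_eqI:
  assumes "fact j \<le> n" "n < fact (Suc j)"
  shows "factorial_block n = Suc j"
  unfolding factorial_block_def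
proof (rule Least_equality)
  fix i assume "n < fact i"
  then have "\<not> i \<le> j"
    using assms(1) fact_mono_nat[of i j] by linarith
  then show "Suc j \<le> i"
    by simp
qed (fact assms(2))

text \<open>A block slope is a difference quotient of \<eta> over one grid cell. The bound is
  uniform in \<open>n\<close>, which makes the step input bounded.\<close>

lemma norm_block_slope_le:
  fixes \<eta> :: "real \<Rightarrow> 'a::real_normed_vector"
  assumes "L-lipschitz_on {0..1} \<eta>"
  shows "norm (block_slope \<eta> n) \<le> L"
proof -
  define N :: real where "N = fact (factorial_block n)"
  have N: "N > 0"
    by (simp add: N_def)
  have "real (Suc n) \<le> real (fact (factorial_block n))"
    using less_fact_factorial_block[of n] by (simp del: of_nat_fact)
  then have le: "real (Suc n) \<le> N"
    by (simp add: N_def)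
  have "real (Suc n) / N \<in> {0..1}" "real n / N \<in> {0..1}"
    using le N by (auto simp: divide_simps)
  then have "norm (\<eta> (real (Suc n) / N) - \<eta> (real n / N)) \<le> L * \<bar>real (Suc n) / N - real n / N\<bar>"
    using lipschitz_onD[OF assms] by (metis dist_norm dist_real_def)
  also have "real (Suc n) / N - real n / N = 1 / N"
    by (simp add: diff_divide_distrib[symmetric])
  finally have "N * norm (\<eta> (real (Suc n) / N) - \<eta> (real n / N)) \<le> L"
    using N by (simp add: field_simps)
  then show ?thesis
    using N by (simp add: block_slope_def Let_def N_def)
qed

text \<open>The mesh is constant within a block, so the slopes telescope there. The right end
  \<open>n = fact (Suc j)\<close> is allowed because the sum stops at \<open>n - 1\<close>.\<close>

lemma sum_block_slope:
  assumes "fact j \<le> n" "n \<le> fact (Suc j)"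
  shows "(\<Sum>i<n. block_slope \<eta> i) = (\<Sum>i<fact j. block_slope \<eta> i)
    + fact (Suc j) *\<^sub>R (\<eta> (real n / fact (Suc j)) - \<eta> (fact j / fact (Suc j)))"
  using assms
proof (induction n rule: dec_induct)
  case base
  then show ?case by simp
next
  case (step n)
  then have "factorial_block n = Suc j"
    by (intro factorial_block_eqI) auto
  then have "block_slope \<eta> n
      = fact (Suc j) *\<^sub>R (\<eta> (real (Suc n) / fact (Suc j)) - \<eta> (real n / fact (Suc j)))"
    by (simp only: block_slope_def Let_def)
  with step show ?case
    by (simp add: algebra_simps del: fact_Suc of_nat_Suc)
qed

section \<open>Error of the rescaled path\<close>

text \<open>The error \<open>e\<close> is Lipschitz with constant \<open>M + L\<close>, vanishes at
  0, and has one common value at all grid points from \<open>1 / (j + 1)\<close> on. Moving from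
  \<open>u\<close> to a grid point, and from \<open>1 / (j + 1)\<close> to 0, costs at most
  \<open>(M + L) / (j + 1)\<close> each.\<close>

lemma rescaled_block_path_error:
  fixes \<eta> :: "real \<Rightarrow> 'a::{banach, second_countable_topology}"
  assumes \<eta>: "L-lipschitz_on {0..1} \<eta>" "\<eta> 0 = 0"
    and l: "M-lipschitz_on {0..} (integrated_path (step_input (block_slope \<eta>)))"
    and u: "u \<in> {0..1}"
  shows "norm (rescaled_path (integrated_path (step_input (block_slope \<eta>))) (fact (Suc j)) u - \<eta> u)
    \<le> 2 * (M + L) / real (Suc j)"
proof -
  define l where "l = integrated_path (step_input (block_slope \<eta>))"
  define N :: real where "N = fact (Suc j)"
  define f where "f = rescaled_path l N"
  have N: "N > 0"
    by (simp add: N_def)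
  have consts_ge0: "M + L \<ge> 0"
    using lipschitz_on_nonneg[OF \<eta>(1)] lipschitz_on_nonneg[OF assms(3)] by simp
  have l_nat: "l (real n) = (\<Sum>i<n. block_slope \<eta> i)" for n
    unfolding l_def by (rule integrated_path_step_input[OF norm_block_slope_le[OF \<eta>(1)]])
  have l0: "l 0 = 0"
    using l_nat[of 0] by simp
  have f: "f x = l (N * x) /\<^sub>R N" for x
    by (simp add: f_def rescaled_path_def l0)
  have f_lip: "M-lipschitz_on {0..1} f"
    unfolding f_def l_def
    by (rule lipschitz_on_subset[OF rescaled_path_lipschitz[OF assms(3) N]]) auto
  define e where "e x = f x - \<eta> x" for x
  have e_lip: "(M + L)-lipschitz_on {0..1} e"
    unfolding e_def using f_lip \<eta>(1) by (rule lipschitz_on_diff)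
  have e_diff: "norm (e x - e y) \<le> (M + L) * \<bar>x - y\<bar>" if "x \<in> {0..1}" "y \<in> {0..1}" for x y
    using lipschitz_onD[OF e_lip that] by (simp add: dist_norm dist_real_def)
  have e0: "e 0 = 0"
    by (simp add: e_def f l0 \<eta>(2))
  have frac: "fact j / N = 1 / real (Suc j)"
    by (simp add: N_def)
  show ?thesis
  proof (cases "u \<le> 1 / real (Suc j)")
    case True
    then have "norm (e u) \<le> (M + L) * (1 / real (Suc j))"
      using e_diff[of u 0] e0 u mult_left_mono[OF True consts_ge0] by simp
    also have "\<dots> \<le> 2 * (M + L) / real (Suc j)"
      using consts_ge0 by (simp add: divide_simps)
    finally show ?thesis
      by (simp add: e_def f_def l_def N_def)
  next
    case False
    \<comment> \<open>The grid point \<open>n / N\<close> is the nearest one to the left of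
      \<open>u\<close>; as \<open>u\<close> exceeds \<open>fact j / N\<close>, it belongs to the
      current block.\<close>
    define n where "n = nat \<lfloor>N * u\<rfloor>"
    have n: "real n \<le> N * u" "N * u < real n + 1"
      using u N by (auto simp: n_def)
    have "fact j = N * (1 / real (Suc j))"
      using frac N by (simp add: field_simps)
    also have "\<dots> \<le> N * u"
      using False N by (intro mult_left_mono) auto
    finally have "fact j \<le> N * u" .
    then have "(fact j :: int) \<le> \<lfloor>N * u\<rfloor>"
      by (simp add: le_floor_iff)
    then have lower: "fact j \<le> n"
      unfolding n_def by (metis nat_int nat_mono of_nat_fact)
    have "N * u \<le> N"
      using u N by (simp add: mult_left_le)
    then have nle: "real n \<le> N"
      using n by linarith
    then have "real n \<le> real (fact (Suc j))"
      by (simp only: N_def of_nat_fact)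
    then have upper: "n \<le> fact (Suc j)"
      by (simp only: of_nat_le_iff)
    have nN: "real n / N \<in> {0..1}"
      using nle N by (simp add: divide_simps)
    have jN: "fact j / N \<in> {0..1}"
      unfolding frac by simp
    txt \<open>Beyond \<open>1 / (j + 1)\<close> the increments of path and target agree on the grid.\<close>
    have "l (real n) = l (fact j) + N *\<^sub>R (\<eta> (real n / N) - \<eta> (fact j / N))"
      using sum_block_slope[OF lower upper, of \<eta>] l_nat[of n] l_nat[of "fact j"]
      by (simp add: N_def)
    then have "l (real n) /\<^sub>R N = l (fact j) /\<^sub>R N + (\<eta> (real n / N) - \<eta> (fact j / N))"
      using N by (simp add: scaleR_add_right)
    then have "e (real n / N) = e (fact j / N)"
      using N by (simp add: e_def f)
    then have "e u = (e u - e (real n / N)) + (e (fact j / N) - e 0)"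
      by (simp add: e0)
    also have "norm \<dots> \<le> (M + L) * \<bar>u - real n / N\<bar> + (M + L) * \<bar>fact j / N - 0\<bar>"
      using e_diff[OF u nN] e_diff[OF jN, of 0] by (intro norm_triangle_mono) auto
    also have "\<dots> \<le> (M + L) * (1 / real (Suc j)) + (M + L) * (1 / real (Suc j))"
    proof (intro add_mono mult_left_mono consts_ge0)
      \<comment> \<open>This crude bound on the mesh \<open>1 / N\<close> gives both error terms the
        same denominator.\<close>
      have "real (Suc j) \<le> N"
        using fact_ge_self[of "Suc j"] unfolding N_def by (metis of_nat_fact of_nat_mono)
      then have "1 / N \<le> 1 / real (Suc j)"
        by (intro divide_left_mono) (use N in auto)
      moreover have "u - real n / N = (N * u - real n) / N"
        using N by (simp add: field_simps)
      then have "\<bar>u - real n / N\<bar> \<le> 1 / N"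
        using n N by (simp add: divide_le_cancel)
      ultimately show "\<bar>u - real n / N\<bar> \<le> 1 / real (Suc j)"
        by simp
    qed (simp add: frac)
    finally show ?thesis
      by (simp add: e_def f_def l_def N_def)
  qed
qed

section \<open>The equivalence\<close>

theorem proposition3p6:
  fixes \<eta> :: "real \<Rightarrow> 'a::{banach, second_countable_topology}"
  assumes "finite_dimensional_type TYPE('a)"
  shows "(\<exists>L. L-lipschitz_on {0..1} \<eta>) \<and> \<eta> 0 = 0 \<longleftrightarrow>
    (\<exists>K T. bounded_measurable_input K \<and> filterlim T at_top sequentially \<and>
       macroscopic_horizontal_path (integrated_path K) T \<eta>)"
proof (intro iffI; elim conjE exE)
  fix L
  assume L: "L-lipschitz_on {0..1} \<eta>" and \<eta>0: "\<eta> 0 = 0"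
  define K where "K = step_input (block_slope \<eta>)"
  \<comment> \<open>These scales are the right ends of the blocks, where the error estimate
    applies.\<close>
  define T :: "nat \<Rightarrow> real" where "T j = fact (Suc j)" for j
  have K: "bounded_measurable_input K"
    unfolding K_def by (rule step_input_bounded_measurable[OF norm_block_slope_le[OF L]])
  then obtain M where M: "M-lipschitz_on {0..} (integrated_path K)"
    by (rule integrated_path_lipschitz)
  have "real j \<le> T j" for j
    unfolding T_def by (metis fact_ge_self le_SucI of_nat_fact of_nat_mono order_trans le_refl)
  then have T: "filterlim T at_top sequentially"
    by (intro filterlim_at_top_mono[OF filterlim_real_sequentially] always_eventually) auto
  have lim0: "(\<lambda>j. 2 * (M + L) / real (Suc j)) \<longlonglongrightarrow> 0"
    by (rule LIMSEQ_Suc[OF lim_const_over_n])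
  have "uniform_limit {0..1} (\<lambda>j. rescaled_path (integrated_path K) (T j)) \<eta> sequentially"
  proof (rule uniform_limitI)
    fix \<epsilon> :: real
    assume "\<epsilon> > 0"
    with lim0 have "\<forall>\<^sub>F j in sequentially. 2 * (M + L) / real (Suc j) < \<epsilon>"
      by (rule order_tendstoD)
    then show "\<forall>\<^sub>F j in sequentially. \<forall>u\<in>{0..1}.
        dist (rescaled_path (integrated_path K) (T j) u) (\<eta> u) < \<epsilon>"
    proof eventually_elim
      case (elim j)
      then show ?case
        using rescaled_block_path_error[OF L \<eta>0 M[unfolded K_def]]
        unfolding T_def K_def dist_norm by (meson le_less_trans)
    qed
  qed
  then have "macroscopic_horizontal_path (integrated_path K) T \<eta>"
    using M T L by (intro lipschitz_imp_macroscopic_horizontal_path) (auto simp: T_def)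
  with K T show "\<exists>K T. bounded_measurable_input K \<and> filterlim T at_top sequentially \<and>
       macroscopic_horizontal_path (integrated_path K) T \<eta>"
    by blast
next
  fix K :: "real \<Rightarrow> 'a" and T
  assume K: "bounded_measurable_input K"
    and "macroscopic_horizontal_path (integrated_path K) T \<eta>"
  then have T: "T j > 0"
    and lim: "uniform_limit {0..1} (\<lambda>j. rescaled_path (integrated_path K) (T j)) \<eta> sequentially"
    for j
    unfolding macroscopic_horizontal_path_def by blast+
  obtain M where M: "M-lipschitz_on {0..} (integrated_path K)"
    using K by (rule integrated_path_lipschitz)
  have ptw: "(\<lambda>j. rescaled_path (integrated_path K) (T j) u) \<longlonglongrightarrow> \<eta> u" if "u \<in> {0..1}" for u
    using lim that by (rule tendsto_uniform_limitI)
  have "M-lipschitz_on {0..1} (rescaled_path (integrated_path K) (T j))" for j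
    by (rule lipschitz_on_subset[OF rescaled_path_lipschitz[OF M T]]) auto
  \<comment> \<open>The constant \<open>M\<close> is common to all scales, so the Lipschitz
    inequality survives the pointwise limit.\<close>
  then have "M-lipschitz_on {0..1} \<eta>"
    using ptw by (rule lipschitz_on_pointwise_limit)
  moreover have "\<eta> 0 = 0"
    \<comment> \<open>Every rescaled path vanishes at 0 by definition.\<close>
    using ptw[of 0] by (simp add: rescaled_path_def LIMSEQ_const_iff)
  ultimately show "(\<exists>L. L-lipschitz_on {0..1} \<eta>) \<and> \<eta> 0 = 0"
    by blast
qed

end
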